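(* Let $U\subseteq\mathbb{M}\mathbb{C}(n)$ be open and let $F:U\to\mathbb{M}\mathbb{C}(n)$ be a function. The following statements are equivalent. (i) $F$ is multicomplex holomorphic on $U$; that is, $F$ is of class $C^1$ and for every $\eta\in U$ there exists $\lambda(\eta)\in\mathbb{M}\mathbb{C}(n)$ such that $DF(\eta)[h]=\lambda(\eta)h$ for all $h\in\mathbb{M}\mathbb{C}(n)$. (ii) For every $\eta_0\in U$, the limit $$F'(\eta_0):=\lim_{\substack{h\to0\\ h\in\mathbb{M}\mathbb{C}(n)^\times}}\frac{F(\eta_0+h)-F(\eta_0)}{h}$$ exists in $\mathbb{M}\mathbb{C}(n)$, where $h$ ranges over the invertible elements such that $\eta_0+h\in U$. (iii) Every point of $U$ admits an idempotent polydisc neighborhood $P(a,r)\subseteq U$ on which $$F(\eta)=\sum_{\boldsymbol{\varepsilon}\in\mathcal{E}_n}\varphi_{\boldsymbol{\varepsilon}}(\eta_{\boldsymbol{\varepsilon}})\,\boldsymbol{\varepsilon},\qquad \eta\in P(a,r),$$ where each $\varphi_{\boldsymbol{\varepsilon}}$ is a holomorphic function of one complex variable on the disc $D_{\boldsymbol{\varepsilon}}:=\{z\in\mathbb{M}\mathbb{C}(1):|z-a_{\boldsymbol{\varepsilon}}|<r\}$. In this case, $F$ is of class $C^\infty$ on $U$ and, for every $\eta\in U$, $$F'(\eta)=\lambda(\eta)=DF(\eta)[1]=\sum_{\boldsymbol{\varepsilon}\in\mathcal{E}_n}\varphi_{\boldsymbol{\varepsilon}}'(\eta_{\boldsymbol{\varepsilon}})\,\boldsymbol{\varepsilon}$$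 in the local representation of (iii).
   Context: Let $n\ge1$. The multicomplex numbers are defined recursively by $\mathbb{M}\mathbb{C}(0)=\mathbb{R}$ and $\mathbb{M}\mathbb{C}(n)=\{\eta_1+\eta_2\mathbf{i}_n:\eta_1,\eta_2\in\mathbb{M}\mathbb{C}(n-1)\}$ with $\mathbf{i}_n^2=-1$, where $\mathbf{i}_n$ is a new formal square root of $-1$ commuting with everything. Thus $\mathbb{M}\mathbb{C}(n)$ is a commutative unital real algebra of dimension $2^n$ generated by commuting units $\mathbf{i}_1,\dots,\mathbf{i}_n$ with $\mathbf{i}_k^2=-1$, and $\mathbb{M}\mathbb{C}(1)\cong\mathbb{C}$ with modulus $|\cdot|$. $\mathbb{M}\mathbb{C}(n)^\times$ is the group of invertible elements, and $w/h$ means $w\,h^{-1}$. For $2\le k\le n$ let $\mathbf{e}_k:=\frac{1+\mathbf{i}_{k-1}\mathbf{i}_k}{2}$ and $\overline{\mathbf{e}}_k:=\frac{1-\mathbf{i}_{k-1}\mathbf{i}_k}{2}$. For $n\ge2$, $\mathcal{E}_n$ is the set of the $2^{n-1}$ products $\boldsymbol{\varepsilon}=\prod_{k=2}^n\boldsymbol{\varepsilon}_k$ with each $\boldsymbol{\varepsilon}_k\in\{\mathbf{e}_k,\overline{\mathbf{e}}_k\}$; $\mathcal{E}_1:=\{1\}$. These are pairwise orthogonal idempotents summing to $1$, and every $\eta\in\mathbb{M}\mathbb{C}(n)$ is uniquely $\eta=\sum_{\boldsymbol{\varepsilon}\in\mathcal{E}_n}\eta_{\boldsymbol{\varepsilon}}\boldsymbol{\varepsilon}$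 with $\eta_{\boldsymbol{\varepsilon}}\in\mathbb{M}\mathbb{C}(1)$; multiplication is componentwise. The norm is $\|\eta\|:=\max_{\boldsymbol{\varepsilon}}|\eta_{\boldsymbol{\varepsilon}}|$, and the idempotent polydisc is $P(a,r):=\{\eta:\|\eta-a\|<r\}$ for $a\in\mathbb{M}\mathbb{C}(n)$, $r>0$. "Class $C^1$" means continuously differentiable as a map between real vector spaces, and $DF(\eta)$ is the real differential at $\eta$. No regularity of $F$ is assumed a priori. *)

theory Defs
  imports "HOL-Analysis.Analysis"
begin

section \<open>Multicomplex numbers\<close>

text \<open>
  \<open>Ext a b\<close> stands for \<open>a + b \<i>\<^sub>n\<close> with \<open>a\<close>, \<open>b\<close> of order \<open>n - 1\<close>, so that
  \<open>MC n\<close> is the recursively defined set of multicomplex numbers of order \<open>n\<close>.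
  The operations below are only meaningful on arguments of one common order.
\<close>

datatype mctree = Scalar real | Ext mctree mctree

fun MC :: "nat \<Rightarrow> mctree set" where
  "MC 0 = range Scalar"
| "MC (Suc n) = {Ext a b |a b. a \<in> MC n \<and> b \<in> MC n}"

fun tconst :: "nat \<Rightarrow> real \<Rightarrow> mctree" where
  "tconst 0 r = Scalar r"
| "tconst (Suc n) r = Ext (tconst n r) (tconst n 0)"

fun tscale :: "real \<Rightarrow> mctree \<Rightarrow> mctree" where
  "tscale r (Scalar a) = Scalar (r * a)"
| "tscale r (Ext a b) = Ext (tscale r a) (tscale r b)"

fun tadd :: "mctree \<Rightarrow> mctree \<Rightarrow> mctree" where
  "tadd (Scalar a) (Scalar b) = Scalar (a + b)"
| "tadd (Ext a b) (Ext c d) = Ext (tadd a c) (tadd b d)"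
| "tadd _ _ = Scalar 0"

fun tmult :: "mctree \<Rightarrow> mctree \<Rightarrow> mctree" where
  "tmult (Scalar a) (Scalar b) = Scalar (a * b)"
| "tmult (Ext a b) (Ext c d) =
     Ext (tadd (tmult a c) (tscale (- 1) (tmult b d))) (tadd (tmult a d) (tmult b c))"
| "tmult _ _ = Scalar 0"

text \<open>
  \<open>tunit n k\<close> is \<open>\<i>\<^sub>k\<close> as an element of \<open>MC n\<close>, for \<open>1 \<le> k \<le> n\<close>; it is \<open>0\<close> for other \<open>k\<close>.
\<close>

fun tunit :: "nat \<Rightarrow> nat \<Rightarrow> mctree" where
  "tunit 0 k = Scalar 0"
| "tunit (Suc n) k =
     (if k = Suc n then Ext (tconst n 0) (tconst n 1) else Ext (tunit n k) (tconst n 0))"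

lemma tconst_MC [simp]: "tconst n r \<in> MC n"
  by (induction n arbitrary: r) auto

lemma tscale_MC [simp]: "a \<in> MC n \<Longrightarrow> tscale r a \<in> MC n"
  by (induction n arbitrary: a) auto

lemma tadd_MC [simp]: "a \<in> MC n \<Longrightarrow> b \<in> MC n \<Longrightarrow> tadd a b \<in> MC n"
  by (induction n arbitrary: a b) auto

lemma tmult_MC [simp]: "a \<in> MC n \<Longrightarrow> b \<in> MC n \<Longrightarrow> tmult a b \<in> MC n"
  by (induction n arbitrary: a b) auto

lemma tunit_MC [simp]: "tunit n k \<in> MC n"
  by (induction n) auto

text \<open>
  The order \<open>n \<ge> 1\<close> is the cardinality of the (otherwise irrelevant) finite index type.
\<close>

typedef 'n multicomplex = "MC CARD('n::finite)"
  using tconst_MC by blast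

setup_lifting type_definition_multicomplex

text \<open>
  Evaluation of a tree of order \<open>n\<close> under \<open>\<i>\<^sub>k \<mapsto> u k\<close>. For \<open>u k \<in> {\<i>, -\<i>}\<close> these are the real
  algebra homomorphisms to the complex numbers; they are jointly injective, which yields
  the ring laws.
\<close>

fun tev :: "(nat \<Rightarrow> complex) \<Rightarrow> nat \<Rightarrow> mctree \<Rightarrow> complex" where
  "tev u n (Scalar r) = of_real r"
| "tev u n (Ext a b) = tev u (n - 1) a + u n * tev u (n - 1) b"

definition unit_choices :: "(nat \<Rightarrow> complex) set" where
  "unit_choices = {u. \<forall>k. u k = \<i> \<or> u k = - \<i>}"

lemma unit_choices_sq: "u \<in> unit_choices \<Longrightarrow> u k * u k = - 1"
  unfolding unit_choices_def by (auto dest: spec[of _ k])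

lemma tev_tconst [simp]: "tev u n (tconst n r) = of_real r"
  by (induction n arbitrary: r) auto

lemma tev_tscale [simp]: "tev u n (tscale r a) = of_real r * tev u n a"
  by (induction a arbitrary: n) (auto simp: algebra_simps)

lemma tev_tadd [simp]:
  "a \<in> MC n \<Longrightarrow> b \<in> MC n \<Longrightarrow> tev u n (tadd a b) = tev u n a + tev u n b"
  by (induction n arbitrary: a b) (auto simp: algebra_simps)

lemma tev_tmult [simp]:
  assumes "u \<in> unit_choices"
  shows "a \<in> MC n \<Longrightarrow> b \<in> MC n \<Longrightarrow> tev u n (tmult a b) = tev u n a * tev u n b"
proof (induction n arbitrary: a b)
  case (Suc n)
  then obtain a1 a2 b1 b2 where
    ab: "a = Ext a1 a2" "b = Ext b1 b2" "a1 \<in> MC n" "a2 \<in> MC n" "b1 \<in> MC n" "b2 \<in> MC n"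
    by auto
  have sq: "u (Suc n) * (u (Suc n) * x) = - x" for x
    using unit_choices_sq[OF assms, of "Suc n"] by (simp flip: mult.assoc)
  then show ?case
    using ab Suc.IH by (simp add: algebra_simps sq)
qed auto

lemma tev_tunit [simp]: "1 \<le> k \<Longrightarrow> k \<le> n \<Longrightarrow> tev u n (tunit n k) = u k"
  by (induction n) auto

lemma tev_cong:
  "(\<And>k. 1 \<le> k \<Longrightarrow> k \<le> n \<Longrightarrow> u k = v k) \<Longrightarrow> a \<in> MC n \<Longrightarrow> tev u n a = tev v n a"
  by (induction n arbitrary: a) auto

lemma tev_cnj: "tev (\<lambda>k. cnj (u k)) n a = cnj (tev u n a)"
  by (induction a arbitrary: n) auto

lemma tev_inject:
  "a \<in> MC n \<Longrightarrow> b \<in> MC n \<Longrightarrow> (\<And>u. u \<in> unit_choices \<Longrightarrow> tev u n a = tev u n b) \<Longrightarrow> a = b"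
proof (induction n arbitrary: a b)
  case 0
  have "(\<lambda>k. \<i>) \<in> unit_choices"
    by (simp add: unit_choices_def)
  with 0 show ?case
    by fastforce
next
  case (Suc n)
  obtain a1 a2 b1 b2 where
    ab: "a = Ext a1 a2" "b = Ext b1 b2" "a1 \<in> MC n" "a2 \<in> MC n" "b1 \<in> MC n" "b2 \<in> MC n"
    using Suc.prems(1,2) by auto
  have *: "tev u n a1 = tev u n b1 \<and> tev u n a2 = tev u n b2" if u: "u \<in> unit_choices" for u
  proof -
    have eq: "tev u n a1 + z * tev u n a2 = tev u n b1 + z * tev u n b2"
      if z: "z = \<i> \<or> z = - \<i>" for z
    proof -
      have "u(Suc n := z) \<in> unit_choices"
        using u z by (auto simp: unit_choices_def)
      moreover have cong: "tev (u(Suc n := z)) n c = tev u n c" if "c \<in> MC n" for c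
        using that by (intro tev_cong) auto
      ultimately show ?thesis
        using Suc.prems(3)[of "u(Suc n := z)"] ab cong
        by (simp del: fun_upd_apply add: fun_upd_same)
    qed
    have "\<i> * (tev u n a2 - tev u n b2) = 0" "tev u n a1 = tev u n b1"
      using eq[of "\<i>"] eq[of "- \<i>"] by (auto simp: algebra_simps complex_eq_iff)
    then show ?thesis
      by simp
  qed
  then show ?case
    using Suc.IH[of a1 b1] Suc.IH[of a2 b2] ab by auto
qed

lift_definition mc_eval :: "(nat \<Rightarrow> complex) \<Rightarrow> 'n::finite multicomplex \<Rightarrow> complex"
  is "\<lambda>u. tev u CARD('n)" .

lift_definition mc_unit :: "nat \<Rightarrow> 'n::finite multicomplex"
  is "tunit CARD('n)" by simp

instantiation multicomplex :: (finite) "{zero, one, plus, minus, uminus, times, scaleR}"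
begin

lift_definition zero_multicomplex :: "'a multicomplex" is "tconst CARD('a) 0" by simp
lift_definition one_multicomplex :: "'a multicomplex" is "tconst CARD('a) 1" by simp
lift_definition plus_multicomplex :: "'a multicomplex \<Rightarrow> 'a multicomplex \<Rightarrow> 'a multicomplex"
  is tadd by simp
lift_definition uminus_multicomplex :: "'a multicomplex \<Rightarrow> 'a multicomplex"
  is "tscale (- 1)" by simp
lift_definition minus_multicomplex :: "'a multicomplex \<Rightarrow> 'a multicomplex \<Rightarrow> 'a multicomplex"
  is "\<lambda>x y. tadd x (tscale (- 1) y)" by simp
lift_definition times_multicomplex :: "'a multicomplex \<Rightarrow> 'a multicomplex \<Rightarrow> 'a multicomplex"
  is tmult by simp
lift_definition scaleR_multicomplex :: "real \<Rightarrow> 'a multicomplex \<Rightarrow> 'a multicomplex"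
  is tscale by simp

instance ..

end

lemma mc_eval_0 [simp]: "mc_eval u 0 = 0"
  by transfer simp

lemma mc_eval_1 [simp]: "mc_eval u 1 = 1"
  by transfer simp

lemma mc_eval_add [simp]: "mc_eval u (x + y) = mc_eval u x + mc_eval u y"
  by transfer simp

lemma mc_eval_uminus [simp]: "mc_eval u (- x) = - mc_eval u x"
  by transfer simp

lemma mc_eval_diff [simp]: "mc_eval u (x - y) = mc_eval u x - mc_eval u y"
  by transfer simp

lemma mc_eval_scaleR [simp]: "mc_eval u (r *\<^sub>R x) = of_real r * mc_eval u x"
  by transfer simp

lemma mc_eval_mult [simp]:
  "u \<in> unit_choices \<Longrightarrow> mc_eval u (x * y) = mc_eval u x * mc_eval u y"
  by transfer simp

lemma mc_eval_unit [simp]: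
  "1 \<le> k \<Longrightarrow> k \<le> CARD('n) \<Longrightarrow> mc_eval u (mc_unit k :: 'n::finite multicomplex) = u k"
  by transfer simp

lemma mc_eval_cong:
  fixes x :: "'n::finite multicomplex"
  shows "(\<And>k. 1 \<le> k \<Longrightarrow> k \<le> CARD('n) \<Longrightarrow> u k = v k) \<Longrightarrow> mc_eval u x = mc_eval v x"
  by transfer (rule tev_cong)

lemma mc_eval_cnj: "mc_eval (\<lambda>k. cnj (u k)) x = cnj (mc_eval u x)"
  by transfer (rule tev_cnj)

lemma mc_eqI: "(\<And>u. u \<in> unit_choices \<Longrightarrow> mc_eval u x = mc_eval u y) \<Longrightarrow> x = y"
  by transfer (rule tev_inject)

instance multicomplex :: (finite) "{comm_ring_1, real_algebra_1}"
proof
  show "(0 :: 'a multicomplex) \<noteq> 1"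
    by (metis mc_eval_0 mc_eval_1 zero_neq_one)
qed (rule mc_eqI; simp add: algebra_simps)+

lemma mc_eval_of_real [simp]: "mc_eval u (of_real r) = of_real r"
  by (simp add: of_real_def)

lemma mc_eval_sum [simp]: "mc_eval u (sum f A) = (\<Sum>x\<in>A. mc_eval u (f x))"
  by (induction A rule: infinite_finite_induct) auto

lemma mc_eval_prod [simp]:
  "u \<in> unit_choices \<Longrightarrow> mc_eval u (prod f A) = (\<Prod>x\<in>A. mc_eval u (f x))"
  by (induction A rule: infinite_finite_induct) auto

lemma mc_unit_sq:
  "1 \<le> k \<Longrightarrow> k \<le> CARD('n) \<Longrightarrow> mc_unit k * mc_unit k = (- 1 :: 'n::finite multicomplex)"
  by (rule mc_eqI) (simp add: unit_choices_sq)

instantiation multicomplex :: (finite) inverse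
begin

definition inverse_multicomplex :: "'a multicomplex \<Rightarrow> 'a multicomplex" where
  "inverse_multicomplex h = (if h dvd 1 then THE g. h * g = 1 else 0)"

definition divide_multicomplex :: "'a multicomplex \<Rightarrow> 'a multicomplex \<Rightarrow> 'a multicomplex" where
  "divide_multicomplex w h = w * inverse h"

instance ..

end

section \<open>Idempotent decomposition and norm\<close>

definition mc_embed :: "complex \<Rightarrow> 'n::finite multicomplex" where
  "mc_embed z = of_real (Re z) + of_real (Im z) * mc_unit 1"

definition mc_e :: "nat \<Rightarrow> 'n::finite multicomplex" where
  "mc_e k = (1 + mc_unit (k - 1) * mc_unit k) /\<^sub>R 2"

definition mc_ebar :: "nat \<Rightarrow> 'n::finite multicomplex" where
  "mc_ebar k = (1 - mc_unit (k - 1) * mc_unit k) /\<^sub>R 2"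

text \<open>For order 1 the product is empty and \<open>mc_idems = {1}\<close>.\<close>

definition mc_idems :: "'n::finite multicomplex set" where
  "mc_idems = {\<Prod>k = 2..CARD('n). f k |f. \<forall>k \<in> {2..CARD('n)}. f k \<in> {mc_e k, mc_ebar k}}"

text \<open>
  The component \<open>\<eta>\<^sub>\<epsilon>\<close>, as a complex number. The family is unique by \<open>mc_comp_ex1\<close> below once it is
  normalised to vanish outside \<open>mc_idems\<close>.
\<close>

definition mc_comp :: "'n::finite multicomplex \<Rightarrow> 'n multicomplex \<Rightarrow> complex" where
  "mc_comp \<eta> = (THE c. (\<forall>\<epsilon>. \<epsilon> \<notin> mc_idems \<longrightarrow> c \<epsilon> = 0) \<and> \<eta> = (\<Sum>\<epsilon>\<in>mc_idems. mc_embed (c \<epsilon>) * \<epsilon>))"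

text \<open>
  To justify this, the idempotents are parametrised by signs, and the component belonging to the
  signs \<open>s\<close> is shown to be the evaluation with \<open>\<i>\<^sub>1 \<mapsto> \<i>\<close> and \<open>\<i>\<^sub>k\<^sub>-\<^sub>1\<i>\<^sub>k \<mapsto> s k\<close>.
\<close>

definition sign_choices :: "nat \<Rightarrow> (nat \<Rightarrow> real) set" where
  "sign_choices n = {2..n} \<rightarrow>\<^sub>E {1, - 1}"

definition sign_idem :: "(nat \<Rightarrow> real) \<Rightarrow> 'n::finite multicomplex" where
  "sign_idem s = (\<Prod>k = 2..CARD('n). (1 + s k *\<^sub>R (mc_unit (k - 1) * mc_unit k)) /\<^sub>R 2)"

fun sign_units :: "(nat \<Rightarrow> real) \<Rightarrow> nat \<Rightarrow> complex" where
  "sign_units s 0 = \<i>"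
| "sign_units s (Suc k) = (if k = 0 \<or> s (Suc k) \<notin> {1, - 1} then \<i>
     else - of_real (s (Suc k)) * sign_units s k)"

lemma sign_units_choices [simp]: "sign_units s \<in> unit_choices"
proof -
  have "sign_units s k = \<i> \<or> sign_units s k = - \<i>" for k
    by (induction k) auto
  then show ?thesis
    by (simp add: unit_choices_def)
qed

lemma sign_units_mult:
  assumes "2 \<le> k" "s k \<in> {1, - 1}"
  shows "sign_units s (k - 1) * sign_units s k = of_real (s k)"
proof -
  obtain j where k: "k = Suc (Suc j)"
    using assms(1) by (metis add_2_eq_Suc le_Suc_ex)
  then show ?thesis
    using assms(2) unit_choices_sq[OF sign_units_choices, of s "Suc j"]
    by (auto simp del: sign_units.simps simp add: sign_units.simps(2)[of s "Suc j"])
qed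

lemma mc_idems_sign_idem: "(mc_idems :: 'n::finite multicomplex set) = sign_idem ` sign_choices CARD('n)"
proof (intro equalityI subsetI)
  fix x :: "'n multicomplex"
  assume "x \<in> mc_idems"
  then obtain f where x: "x = (\<Prod>k = 2..CARD('n). f k)"
    and f: "\<forall>k \<in> {2..CARD('n)}. f k \<in> {mc_e k, mc_ebar k}"
    unfolding mc_idems_def by blast
  define s :: "nat \<Rightarrow> real" where
    "s = restrict (\<lambda>k. if f k = mc_e k then 1 else - 1) {2..CARD('n)}"
  have "s \<in> sign_choices CARD('n)"
    by (auto simp: s_def sign_choices_def)
  moreover have "x = sign_idem s"
    unfolding x sign_idem_def using f
    by (intro prod.cong) (auto simp: s_def mc_e_def mc_ebar_def)
  ultimately show "x \<in> sign_idem ` sign_choices CARD('n)"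
    by blast
next
  fix x :: "'n multicomplex"
  assume "x \<in> sign_idem ` sign_choices CARD('n)"
  then obtain s where s: "s \<in> sign_choices CARD('n)" and x: "x = sign_idem s"
    by blast
  have "\<forall>k \<in> {2..CARD('n)}. (1 + s k *\<^sub>R (mc_unit (k - 1) * mc_unit k)) /\<^sub>R 2
          \<in> {mc_e k, mc_ebar k :: 'n multicomplex}"
  proof
    fix k assume "k \<in> {2..CARD('n)}"
    then have "s k = 1 \<or> s k = - 1"
      using s by (auto simp: sign_choices_def PiE_iff)
    then show "(1 + s k *\<^sub>R (mc_unit (k - 1) * mc_unit k)) /\<^sub>R 2
          \<in> {mc_e k, mc_ebar k :: 'n multicomplex}"
      by (auto simp: mc_e_def mc_ebar_def)
  qed
  then show "x \<in> mc_idems"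
    unfolding mc_idems_def x sign_idem_def by blast
qed

lemma finite_sign_choices: "finite (sign_choices n)"
  unfolding sign_choices_def by (rule finite_PiE) auto

lemma finite_mc_idems [simp]: "finite mc_idems"
  by (simp add: mc_idems_sign_idem finite_sign_choices)

lemma mc_eval_sign_idem:
  assumes u: "u \<in> unit_choices" and s: "s \<in> sign_choices CARD('n)"
  shows "mc_eval u (sign_idem s :: 'n::finite multicomplex) =
    (if \<forall>k\<in>{2..CARD('n)}. u (k - 1) * u k = of_real (s k) then 1 else 0)"
proof -
  define g where "g k = (1 + of_real (s k) * (u (k - 1) * u k)) / 2" for k
  have g: "mc_eval u (sign_idem s :: 'n multicomplex) = (\<Prod>k = 2..CARD('n). g k)"
    unfolding sign_idem_def using u
    by (simp, intro prod.cong) (auto simp: g_def field_simps)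
  have *: "g k = (if u (k - 1) * u k = of_real (s k) then 1 else 0)" if "k \<in> {2..CARD('n)}" for k
  proof -
    have "s k = 1 \<or> s k = - 1"
      using s that by (auto simp: sign_choices_def PiE_iff)
    moreover have "(u (k - 1) = \<i> \<or> u (k - 1) = - \<i>) \<and> (u k = \<i> \<or> u k = - \<i>)"
      using u by (simp add: unit_choices_def)
    ultimately show ?thesis
      unfolding g_def by auto
  qed
  show ?thesis
  proof (cases "\<forall>k\<in>{2..CARD('n)}. u (k - 1) * u k = of_real (s k)")
    case True
    then show ?thesis
      unfolding g using * by simp
  next
    case False
    then show ?thesis
      unfolding g using * by (auto intro!: prod_zero)
  qed
qed

lemma mc_eval_sign_idem_sign_units:
  assumes s: "s \<in> sign_choices CARD('n)" and t: "t \<in> sign_choices CARD('n)"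
  shows "mc_eval (sign_units s) (sign_idem t :: 'n::finite multicomplex) = (if s = t then 1 else 0)"
proof -
  have "s k \<in> {1, - 1}" if "k \<in> {2..CARD('n)}" for k
    using s that unfolding sign_choices_def by (rule PiE_mem)
  then have "(\<forall>k\<in>{2..CARD('n)}. sign_units s (k - 1) * sign_units s k = of_real (t k)) \<longleftrightarrow>
      (\<forall>k\<in>{2..CARD('n)}. s k = t k)"
    by (intro ball_cong refl) (simp only: sign_units_mult atLeastAtMost_iff of_real_eq_iff)
  also have "\<dots> \<longleftrightarrow> s = t"
    using s t unfolding sign_choices_def by (auto intro: PiE_ext)
  finally show ?thesis
    by (simp add: mc_eval_sign_idem[OF sign_units_choices t])
qed

lemma inj_on_sign_idem: "inj_on (sign_idem :: _ \<Rightarrow> 'n::finite multicomplex) (sign_choices CARD('n))"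
  by (intro inj_onI) (metis mc_eval_sign_idem_sign_units zero_neq_one)

lemma card_mc_idems: "card (mc_idems :: 'n::finite multicomplex set) = 2 ^ (CARD('n) - 1)"
  by (simp add: mc_idems_sign_idem card_image[OF inj_on_sign_idem])
    (simp add: sign_choices_def card_PiE numeral_2_eq_2)

lemma mc_eval_embed:
  "u \<in> unit_choices \<Longrightarrow> mc_eval u (mc_embed z :: 'n::finite multicomplex) = of_real (Re z) + of_real (Im z) * u 1"
  by (simp add: mc_embed_def)

lemma mc_eval_embed_sign_units [simp]: "mc_eval (sign_units s) (mc_embed z) = z"
  by (simp add: mc_eval_embed complex_eq_iff)

lemma mc_eval_expansion:
  fixes c :: "'n::finite multicomplex \<Rightarrow> complex"
  assumes s: "s \<in> sign_choices CARD('n)"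
  shows "mc_eval (sign_units s) (\<Sum>\<epsilon>\<in>mc_idems. mc_embed (c \<epsilon>) * \<epsilon>) = c (sign_idem s)"
proof -
  have "mc_eval (sign_units s) (\<Sum>\<epsilon>\<in>mc_idems. mc_embed (c \<epsilon>) * \<epsilon>) =
      (\<Sum>t\<in>sign_choices CARD('n). c (sign_idem t) * (if s = t then 1 else 0))"
    by (simp add: mc_idems_sign_idem sum.reindex[OF inj_on_sign_idem] mc_eval_sign_idem_sign_units[OF s]
        cong: sum.cong)
  also have "\<dots> = c (sign_idem s)"
    using s finite_sign_choices by (simp add: if_distrib[of "(*) _"] cong: if_cong)
  finally show ?thesis .
qed

lemma mc_eqI_sign:
  fixes x y :: "'n::finite multicomplex"
  assumes eq: "\<And>s. s \<in> sign_choices CARD('n) \<Longrightarrow> mc_eval (sign_units s) x = mc_eval (sign_units s) y"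
  shows "x = y"
proof (rule mc_eqI)
  fix u assume u: "u \<in> unit_choices"
  have one: "mc_eval v x = mc_eval v y" if v: "v \<in> unit_choices" and v1: "v 1 = \<i>" for v
  proof -
    define s where "s = restrict (\<lambda>k. Re (v (k - 1) * v k)) {2..CARD('n)}"
    have vk: "v k = \<i> \<or> v k = - \<i>" for k
      using v by (simp add: unit_choices_def)
    have s: "s \<in> sign_choices CARD('n)"
      unfolding s_def sign_choices_def
    proof (rule restrict_PiE_iff[THEN iffD2], rule ballI)
      fix k
      show "Re (v (k - 1) * v k) \<in> {1, - 1}"
        using vk[of k] vk[of "k - 1"] by auto
    qed
    have "v k = sign_units s k" if "1 \<le> k" "k \<le> CARD('n)" for k
      using that
    proof (induction k rule: dec_induct)
      case base
      then show ?case
        using v1 by simp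
    next
      case (step k)
      then have IH: "v k = sign_units s k"
        by simp
      have "s (Suc k) = Re (v k * v (Suc k))"
        using step by (simp add: s_def)
      with vk[of k] vk[of "Suc k"] step.hyps show ?case
        by (auto simp flip: IH)
    qed
    then have "mc_eval v z = mc_eval (sign_units s) z" for z :: "'n multicomplex"
      by (rule mc_eval_cong)
    then show ?thesis
      using eq[OF s] by simp
  qed
  consider "u 1 = \<i>" | "u 1 = - \<i>"
    using u by (auto simp: unit_choices_def)
  then show "mc_eval u x = mc_eval u y"
  proof cases
    case 1
    then show ?thesis
      using one u by blast
  next
    case 2
    have "(\<lambda>k. cnj (u k)) \<in> unit_choices"
      using u by (auto simp: unit_choices_def complex_eq_iff)
    then have "mc_eval (\<lambda>k. cnj (u k)) x = mc_eval (\<lambda>k. cnj (u k)) y"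
      using 2 by (intro one) auto
    then show ?thesis
      by (simp add: mc_eval_cnj)
  qed
qed

lemma mc_comp_ex1:
  fixes \<eta> :: "'n::finite multicomplex"
  shows "\<exists>!c. (\<forall>\<epsilon>. \<epsilon> \<notin> mc_idems \<longrightarrow> c \<epsilon> = 0) \<and> \<eta> = (\<Sum>\<epsilon>\<in>mc_idems. mc_embed (c \<epsilon>) * \<epsilon>)"
proof (rule ex_ex1I)
  define c :: "'n multicomplex \<Rightarrow> complex" where "c \<epsilon> = (if \<epsilon> \<in> mc_idems then
    mc_eval (sign_units (inv_into (sign_choices CARD('n)) sign_idem \<epsilon>)) \<eta> else 0)" for \<epsilon>
  have "c (sign_idem s) = mc_eval (sign_units s) \<eta>" if "s \<in> sign_choices CARD('n)" for s
    using that by (auto simp: c_def mc_idems_sign_idem inv_into_f_f[OF inj_on_sign_idem])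
  then have "\<eta> = (\<Sum>\<epsilon>\<in>mc_idems. mc_embed (c \<epsilon>) * \<epsilon>)"
    by (intro mc_eqI_sign) (simp only: mc_eval_expansion)
  then show "\<exists>c. (\<forall>\<epsilon>. \<epsilon> \<notin> mc_idems \<longrightarrow> c \<epsilon> = 0) \<and> \<eta> = (\<Sum>\<epsilon>\<in>mc_idems. mc_embed (c \<epsilon>) * \<epsilon>)"
    by (intro exI[of _ c]) (simp add: c_def)
next
  fix c d
  assume c: "(\<forall>\<epsilon>. \<epsilon> \<notin> mc_idems \<longrightarrow> c \<epsilon> = 0) \<and> \<eta> = (\<Sum>\<epsilon>\<in>mc_idems. mc_embed (c \<epsilon>) * \<epsilon>)"
    and d: "(\<forall>\<epsilon>. \<epsilon> \<notin> mc_idems \<longrightarrow> d \<epsilon> = 0) \<and> \<eta> = (\<Sum>\<epsilon>\<in>mc_idems. mc_embed (d \<epsilon>) * \<epsilon>)"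
  have "c (sign_idem s) = d (sign_idem s)" if "s \<in> sign_choices CARD('n)" for s
    using mc_eval_expansion[OF that, of c] mc_eval_expansion[OF that, of d] c d by argo
  then have "c \<epsilon> = d \<epsilon>" if "\<epsilon> \<in> mc_idems" for \<epsilon>
    using that by (auto simp: mc_idems_sign_idem)
  then show "c = d"
    using c d by fastforce
qed

lemma mc_comp_expansion:
  fixes \<eta> :: "'n::finite multicomplex"
  shows "(\<Sum>\<epsilon>\<in>mc_idems. mc_embed (mc_comp \<eta> \<epsilon>) * \<epsilon>) = \<eta>"
  using theI'[OF mc_comp_ex1[of \<eta>]] unfolding mc_comp_def by metis

lemma mc_comp_sign_idem:
  fixes \<eta> :: "'n::finite multicomplex"
  assumes "s \<in> sign_choices CARD('n)"
  shows "mc_comp \<eta> (sign_idem s) = mc_eval (sign_units s) \<eta>"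
  using mc_eval_expansion[OF assms, of "mc_comp \<eta>"] by (simp add: mc_comp_expansion)

lemma mc_idems_cases:
  fixes \<epsilon> :: "'n::finite multicomplex"
  assumes "\<epsilon> \<in> mc_idems"
  obtains s where "s \<in> sign_choices CARD('n)" "\<epsilon> = sign_idem s"
  using assms by (auto simp: mc_idems_sign_idem)

lemma mc_comp_add: "\<epsilon> \<in> mc_idems \<Longrightarrow> mc_comp (x + y) \<epsilon> = mc_comp x \<epsilon> + mc_comp y \<epsilon>"
  by (auto simp: mc_comp_sign_idem elim!: mc_idems_cases)

lemma mc_comp_mult: "\<epsilon> \<in> mc_idems \<Longrightarrow> mc_comp (x * y) \<epsilon> = mc_comp x \<epsilon> * mc_comp y \<epsilon>"
  by (auto simp: mc_comp_sign_idem elim!: mc_idems_cases)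

lemma mc_comp_scaleR: "\<epsilon> \<in> mc_idems \<Longrightarrow> mc_comp (r *\<^sub>R x) \<epsilon> = of_real r * mc_comp x \<epsilon>"
  by (auto simp: mc_comp_sign_idem elim!: mc_idems_cases)

lemma mc_comp_0: "\<epsilon> \<in> mc_idems \<Longrightarrow> mc_comp 0 \<epsilon> = 0"
  by (auto simp: mc_comp_sign_idem elim!: mc_idems_cases)

lemma mc_comp_1: "\<epsilon> \<in> mc_idems \<Longrightarrow> mc_comp 1 \<epsilon> = 1"
  by (auto simp: mc_comp_sign_idem elim!: mc_idems_cases)

lemma mc_idems_nonempty [simp]: "(mc_idems :: 'n::finite multicomplex set) \<noteq> {}"
  using mc_comp_expansion[of "1 :: 'n multicomplex"] by force

instantiation multicomplex :: (finite) real_normed_algebra_1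
begin

definition norm_multicomplex :: "'a multicomplex \<Rightarrow> real" where
  "norm_multicomplex \<eta> = (MAX \<epsilon>\<in>mc_idems. cmod (mc_comp \<eta> \<epsilon>))"

definition dist_multicomplex :: "'a multicomplex \<Rightarrow> 'a multicomplex \<Rightarrow> real" where
  "dist_multicomplex x y = norm (x - y)"

definition sgn_multicomplex :: "'a multicomplex \<Rightarrow> 'a multicomplex" where
  "sgn_multicomplex x = x /\<^sub>R norm x"

definition uniformity_multicomplex :: "('a multicomplex \<times> 'a multicomplex) filter" where
  "uniformity_multicomplex = (INF e\<in>{0<..}. principal {(x, y). dist x y < e})"

definition open_multicomplex :: "'a multicomplex set \<Rightarrow> bool" where
  "open_multicomplex U \<longleftrightarrow> (\<forall>x\<in>U. \<forall>\<^sub>F (x', y) in uniformity. x' = x \<longrightarrow> y \<in> U)"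

instance
proof
  fix x y :: "'a multicomplex" and r :: real
  have le: "cmod (mc_comp z \<epsilon>) \<le> norm z" if "\<epsilon> \<in> mc_idems" for z \<epsilon> :: "'a multicomplex"
    unfolding norm_multicomplex_def using that by (intro Max_ge) auto
  have leI: "norm z \<le> B" if "\<And>\<epsilon>. \<epsilon> \<in> mc_idems \<Longrightarrow> cmod (mc_comp z \<epsilon>) \<le> B" for z :: "'a multicomplex" and B
    unfolding norm_multicomplex_def using that by (subst Max_le_iff) auto
  obtain \<epsilon> :: "'a multicomplex" where \<epsilon>: "\<epsilon> \<in> mc_idems"
    using mc_idems_nonempty by blast
  have nonneg: "0 \<le> norm z" for z :: "'a multicomplex"
    using le[OF \<epsilon>] norm_ge_zero order_trans by blast
  show "dist x y = norm (x - y)"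
    by (rule dist_multicomplex_def)
  show "sgn x = x /\<^sub>R norm x"
    by (rule sgn_multicomplex_def)
  show "(uniformity :: ('a multicomplex \<times> 'a multicomplex) filter) =
      (INF e\<in>{0<..}. principal {(x, y). dist x y < e})"
    by (rule uniformity_multicomplex_def)
  show "open U \<longleftrightarrow> (\<forall>x\<in>U. \<forall>\<^sub>F (x', y) in uniformity. x' = x \<longrightarrow> y \<in> U)" for U :: "'a multicomplex set"
    by (rule open_multicomplex_def)
  show "norm x = 0 \<longleftrightarrow> x = 0"
  proof
    assume "norm x = 0"
    then have "mc_comp x \<epsilon> = 0" if "\<epsilon> \<in> mc_idems" for \<epsilon>
      using le[OF that, of x] by simp
    then show "x = 0"
      using mc_comp_expansion[of x] by (simp add: mc_embed_def)
  next
    assume "x = 0"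
    then have "norm x \<le> 0"
      by (intro leI) (simp add: mc_comp_0)
    with nonneg[of x] show "norm x = 0"
      by simp
  qed
  show "norm (x + y) \<le> norm x + norm y"
    by (rule leI) (simp add: mc_comp_add le add_mono norm_triangle_le)
  show "norm (x * y) \<le> norm x * norm y"
    by (rule leI) (simp add: mc_comp_mult norm_mult le mult_mono nonneg)
  show "norm (1 :: 'a multicomplex) = 1"
  proof (rule antisym)
    show "norm (1 :: 'a multicomplex) \<le> 1"
      by (rule leI) (simp add: mc_comp_1)
    show "1 \<le> norm (1 :: 'a multicomplex)"
      using le[OF \<epsilon>, of 1] by (simp add: mc_comp_1 \<epsilon>)
  qed
  show "norm (r *\<^sub>R x) = \<bar>r\<bar> * norm x"
  proof (rule antisym)
    show "norm (r *\<^sub>R x) \<le> \<bar>r\<bar> * norm x"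
      by (rule leI) (simp add: mc_comp_scaleR norm_mult le mult_left_mono)
    have "norm x \<in> (\<lambda>\<epsilon>. cmod (mc_comp x \<epsilon>)) ` mc_idems"
      unfolding norm_multicomplex_def by (intro Max_in) auto
    then obtain \<delta> where \<delta>: "\<delta> \<in> mc_idems" "norm x = cmod (mc_comp x \<delta>)"
      by blast
    show "\<bar>r\<bar> * norm x \<le> norm (r *\<^sub>R x)"
      using le[OF \<delta>(1), of "r *\<^sub>R x"] \<delta> by (simp add: mc_comp_scaleR norm_mult)
  qed
qed

end

definition polydisc :: "'n::finite multicomplex \<Rightarrow> real \<Rightarrow> 'n multicomplex set" where
  "polydisc a r = {\<eta>. norm (\<eta> - a) < r}"

section \<open>Regularity and multicomplex holomorphy\<close>

text \<open>
  Class \<open>C\<^sup>k\<close> on an open subset of a finite-dimensional space: there, continuity of the derivative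
  is the same as continuity of all directional derivatives \<open>x \<mapsto> DF(x)[h]\<close>.
\<close>

fun Ck_on :: "nat \<Rightarrow> 'a::real_normed_vector set \<Rightarrow> ('a \<Rightarrow> 'b::real_normed_vector) \<Rightarrow> bool" where
  "Ck_on 0 U F \<longleftrightarrow> continuous_on U F"
| "Ck_on (Suc k) U F \<longleftrightarrow> (\<forall>x\<in>U. F differentiable (at x)) \<and>
     (\<forall>h. Ck_on k U (\<lambda>x. frechet_derivative F (at x) h))"

definition mc_holomorphic_on ::
  "('n::finite multicomplex \<Rightarrow> 'n multicomplex) \<Rightarrow> 'n multicomplex set \<Rightarrow> bool" where
  "mc_holomorphic_on F U \<longleftrightarrow> Ck_on 1 U F \<and>
     (\<forall>\<eta>\<in>U. \<exists>lam. \<forall>h. frechet_derivative F (at \<eta>) h = lam * h)"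

definition mc_incr :: "'n::finite multicomplex set \<Rightarrow> 'n multicomplex \<Rightarrow> 'n multicomplex filter" where
  "mc_incr U \<eta>\<^sub>0 = at 0 within {h. h dvd 1 \<and> \<eta>\<^sub>0 + h \<in> U}"

definition mc_quotient ::
  "('n::finite multicomplex \<Rightarrow> 'n multicomplex) \<Rightarrow> 'n multicomplex \<Rightarrow> 'n multicomplex \<Rightarrow> 'n multicomplex" where
  "mc_quotient F \<eta>\<^sub>0 h = (F (\<eta>\<^sub>0 + h) - F \<eta>\<^sub>0) / h"

definition mc_deriv ::
  "('n::finite multicomplex \<Rightarrow> 'n multicomplex) \<Rightarrow> 'n multicomplex set \<Rightarrow> 'n multicomplex \<Rightarrow> 'n multicomplex" where
  "mc_deriv F U \<eta>\<^sub>0 = Lim (mc_incr U \<eta>\<^sub>0) (mc_quotient F \<eta>\<^sub>0)"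

definition mc_split_on ::
  "('n::finite multicomplex \<Rightarrow> 'n multicomplex) \<Rightarrow> 'n multicomplex \<Rightarrow> real \<Rightarrow>
     ('n multicomplex \<Rightarrow> complex \<Rightarrow> complex) \<Rightarrow> bool" where
  "mc_split_on F a r \<phi> \<longleftrightarrow>
     (\<forall>\<epsilon>\<in>mc_idems. \<phi> \<epsilon> holomorphic_on {z. cmod (z - mc_comp a \<epsilon>) < r}) \<and>
     (\<forall>\<eta>\<in>polydisc a r. F \<eta> = (\<Sum>\<epsilon>\<in>mc_idems. mc_embed (\<phi> \<epsilon> (mc_comp \<eta> \<epsilon>)) * \<epsilon>))"

end

theory Submission
  imports Defs "HOL-Complex_Analysis.Cauchy_Integral_Formula"
begin

text \<open>
  In idempotent coordinates a multicomplex number is a tuple of complex numbers, a product is taken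
  componentwise, and an increment is invertible iff none of its components vanishes. All three
  conditions are compared with one pointwise notion, \<open>has_mc_derivative\<close>: each component of
  \<open>F (\<eta> + h) - F \<eta> - \<lambda> h\<close> is small compared with the \<^emph>\<open>same\<close> component of \<open>h\<close>. This is stronger
  than real differentiability with differential \<open>h \<mapsto> \<lambda> h\<close>, where the error is only compared with
  the largest component of \<open>h\<close>.

  The difference quotients converge at every point of \<open>U\<close> iff \<open>F\<close> has such a derivative at every
  point. Division by an invertible \<open>h\<close> makes the estimate for invertible \<open>h\<close> equivalent to
  convergence at a single point. The estimate for the remaining \<open>h\<close> is a limit of
  estimates for invertible ones: convergence of the quotients at the point \<open>\<eta> + h\<close> forces
  \<open>F (\<eta> + h + t) \<rightarrow> F (\<eta> + h)\<close> as the real number \<open>t\<close> decreases to \<open>0\<close>, and \<open>h + t\<close> is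
  invertible for small \<open>t > 0\<close> (\<open>tendsto_quotients_imp_has_mc_derivative\<close>).

  A differential \<open>h \<mapsto> \<lambda> h\<close> kills, in the component \<open>\<epsilon>\<close>, every \<open>h\<close> whose component \<open>\<epsilon>\<close> is zero.
  Hence on a polydisc, which is convex, the component \<open>\<epsilon>\<close> of \<open>F\<close> depends on the component \<open>\<epsilon>\<close> of the
  argument alone, and as a function of it is complex differentiable at every point, that is,
  holomorphic (\<open>mc_linear_derivative_imp_split\<close>). Conversely, differentiability of the functions of
  one variable in a splitting is precisely the componentwise estimate
  (\<open>mc_split_imp_has_mc_derivative\<close>), which returns both the differential and the limit of the
  quotients. Finally, the directional derivatives of a split function are split again, because
  derivatives of holomorphic functions are holomorphic; by induction \<open>F\<close> is smooth.
\<close>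

section \<open>Idempotent components\<close>

lemma mc_comp_sum_idems:
  assumes "\<epsilon> \<in> mc_idems"
  shows "mc_comp (\<Sum>\<delta>\<in>mc_idems. mc_embed (c \<delta>) * \<delta>) \<epsilon> = c \<epsilon>"
  using assms by (auto simp: mc_comp_sign_idem mc_eval_expansion simp del: mc_eval_sum elim!: mc_idems_cases)

lemma mc_comp_embed: "\<epsilon> \<in> mc_idems \<Longrightarrow> mc_comp (mc_embed z) \<epsilon> = z"
  by (auto simp: mc_comp_sign_idem elim!: mc_idems_cases)

lemma mc_comp_idem:
  fixes \<delta> \<epsilon> :: "'n::finite multicomplex"
  assumes "\<delta> \<in> mc_idems" "\<epsilon> \<in> mc_idems"
  shows "mc_comp \<delta> \<epsilon> = (if \<epsilon> = \<delta> then 1 else 0)"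
proof -
  obtain s t where "s \<in> sign_choices CARD('n)" "\<epsilon> = sign_idem s"
    "t \<in> sign_choices CARD('n)" "\<delta> = sign_idem t"
    using assms by (meson mc_idems_cases)
  then show ?thesis
    using inj_on_sign_idem
    by (auto simp: mc_comp_sign_idem mc_eval_sign_idem_sign_units dest: inj_onD)
qed

lemma mc_eqI_comp: "(\<And>\<epsilon>. \<epsilon> \<in> mc_idems \<Longrightarrow> mc_comp x \<epsilon> = mc_comp y \<epsilon>) \<Longrightarrow> x = y"
  by (metis (no_types, lifting) mc_comp_expansion sum.cong)

lemma mc_comp_diff: "\<epsilon> \<in> mc_idems \<Longrightarrow> mc_comp (x - y) \<epsilon> = mc_comp x \<epsilon> - mc_comp y \<epsilon>"
  by (auto simp: mc_comp_sign_idem elim!: mc_idems_cases)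

lemma mc_comp_of_real: "\<epsilon> \<in> mc_idems \<Longrightarrow> mc_comp (of_real t) \<epsilon> = of_real t"
  by (simp add: of_real_def mc_comp_scaleR mc_comp_1)

lemmas mc_comp_simps =
  mc_comp_add mc_comp_diff mc_comp_mult mc_comp_scaleR mc_comp_0 mc_comp_1 mc_comp_of_real
  mc_comp_embed mc_comp_idem

lemma norm_mc_less_iff: "norm z < r \<longleftrightarrow> (\<forall>\<epsilon>\<in>mc_idems. cmod (mc_comp z \<epsilon>) < r)"
  unfolding norm_multicomplex_def by (subst Max_less_iff) auto

lemma norm_mc_le_iff: "norm z \<le> r \<longleftrightarrow> (\<forall>\<epsilon>\<in>mc_idems. cmod (mc_comp z \<epsilon>) \<le> r)"
  unfolding norm_multicomplex_def by (subst Max_le_iff) auto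

lemma cmod_mc_comp_le: "\<epsilon> \<in> mc_idems \<Longrightarrow> cmod (mc_comp z \<epsilon>) \<le> norm z"
  using norm_mc_le_iff by blast

lemma bounded_linear_mc_comp:
  assumes "\<epsilon> \<in> mc_idems"
  shows "bounded_linear (\<lambda>x. mc_comp x \<epsilon>)"
  by (rule bounded_linear_intro[where K = 1])
    (use assms in \<open>auto simp: mc_comp_simps cmod_mc_comp_le scaleR_conv_of_real\<close>)

lemma bounded_linear_mc_embed_mult:
  assumes "\<epsilon> \<in> mc_idems"
  shows "bounded_linear (\<lambda>z. mc_embed z * \<epsilon>)"
proof (rule bounded_linear_intro[where K = 1])
  show "norm (mc_embed z * \<epsilon>) \<le> norm z * 1" for z
    unfolding norm_mc_le_iff using assms by (auto simp: mc_comp_simps)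
qed (rule mc_eqI_comp; use assms in \<open>auto simp: mc_comp_simps distrib_right scaleR_conv_of_real\<close>)+

text \<open>
  The norm is the maximum of finitely many components, so convergence is componentwise; both
  directions are linear continuity, of the projections and of the reassembly.
\<close>

lemma tendsto_mc_iff:
  "(f \<longlongrightarrow> L) G \<longleftrightarrow> (\<forall>\<epsilon>\<in>mc_idems. ((\<lambda>x. mc_comp (f x) \<epsilon>) \<longlongrightarrow> mc_comp L \<epsilon>) G)"
proof
  assume "(f \<longlongrightarrow> L) G"
  then show "\<forall>\<epsilon>\<in>mc_idems. ((\<lambda>x. mc_comp (f x) \<epsilon>) \<longlongrightarrow> mc_comp L \<epsilon>) G"
    by (blast intro: bounded_linear.tendsto[OF bounded_linear_mc_comp])
next
  assume "\<forall>\<epsilon>\<in>mc_idems. ((\<lambda>x. mc_comp (f x) \<epsilon>) \<longlongrightarrow> mc_comp L \<epsilon>) G"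
  then have "((\<lambda>x. \<Sum>\<epsilon>\<in>mc_idems. mc_embed (mc_comp (f x) \<epsilon>) * \<epsilon>) \<longlongrightarrow>
      (\<Sum>\<epsilon>\<in>mc_idems. mc_embed (mc_comp L \<epsilon>) * \<epsilon>)) G"
    by (intro tendsto_sum bounded_linear.tendsto[OF bounded_linear_mc_embed_mult]) auto
  then show "(f \<longlongrightarrow> L) G"
    by (simp add: mc_comp_expansion)
qed

text \<open>The inverse is obtained by inverting each component.\<close>

lemma mc_dvd_1_iff: "h dvd 1 \<longleftrightarrow> (\<forall>\<epsilon>\<in>mc_idems. mc_comp h \<epsilon> \<noteq> 0)"
proof
  assume "h dvd 1"
  then obtain g where "1 = h * g"
    by (elim dvdE)
  then show "\<forall>\<epsilon>\<in>mc_idems. mc_comp h \<epsilon> \<noteq> 0"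
    by (metis mc_comp_1 mc_comp_mult mult_zero_left zero_neq_one)
next
  assume "\<forall>\<epsilon>\<in>mc_idems. mc_comp h \<epsilon> \<noteq> 0"
  then have "1 = h * (\<Sum>\<epsilon>\<in>mc_idems. mc_embed (inverse (mc_comp h \<epsilon>)) * \<epsilon>)"
    by (intro mc_eqI_comp) (simp add: mc_comp_simps mc_comp_sum_idems)
  then show "h dvd 1"
    by (rule dvdI)
qed

lemma mc_comp_divide:
  fixes h :: "'n::finite multicomplex"
  assumes "h dvd 1" "\<epsilon> \<in> mc_idems"
  shows "mc_comp (w / h) \<epsilon> = mc_comp w \<epsilon> / mc_comp h \<epsilon>"
proof -
  obtain g where g: "h * g = 1"
    using assms(1) by (metis dvdE)
  have "g' = g" if "h * g' = 1" for g'
  proof -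
    have "g' = g' * (h * g)"
      by (simp add: g)
    also have "\<dots> = (h * g') * g"
      by (simp only: mult_ac)
    finally show ?thesis
      by (simp add: that)
  qed
  then have "(THE g. h * g = 1) = g"
    using g by (intro the_equality)
  then have "inverse h = g"
    by (simp add: inverse_multicomplex_def assms(1))
  moreover have "mc_comp h \<epsilon> * mc_comp g \<epsilon> = 1"
    using mc_comp_mult[OF assms(2), of h g] by (simp add: g mc_comp_1 assms(2))
  then have "mc_comp g \<epsilon> = inverse (mc_comp h \<epsilon>)"
    by (rule inverse_unique[symmetric])
  ultimately show ?thesis
    using assms(2) by (simp add: divide_multicomplex_def mc_comp_mult divide_inverse)
qed

lemma polydisc_eq_ball: "polydisc a r = ball a r"
  by (simp add: polydisc_def ball_def dist_norm norm_minus_commute)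

section \<open>Componentwise differentiability\<close>

text \<open>
  The right-hand side carries \<open>\<bar>h\<^sub>\<epsilon>\<bar>\<close> rather than \<open>\<parallel>h\<parallel>\<close>: an invertible \<open>h\<close> may have components of
  very different sizes, so an error \<open>o(\<parallel>h\<parallel>)\<close> would give no control of the quotients. Writing the
  condition as an estimate also gives it content for those \<open>h\<close> by which one cannot divide.
\<close>

definition has_mc_derivative ::
  "('n::finite multicomplex \<Rightarrow> 'n multicomplex) \<Rightarrow> 'n multicomplex \<Rightarrow> 'n multicomplex \<Rightarrow> bool" where
  "has_mc_derivative F lam \<eta> \<longleftrightarrow> (\<forall>\<epsilon>\<in>mc_idems. \<forall>e>0. \<forall>\<^sub>F h in nhds 0.
     cmod (mc_comp (F (\<eta> + h) - F \<eta> - lam * h) \<epsilon>) \<le> e * cmod (mc_comp h \<epsilon>))"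

lemma has_mc_derivative_imp_has_derivative:
  assumes "has_mc_derivative F lam \<eta>"
  shows "(F has_derivative (\<lambda>h. lam * h)) (at \<eta>)"
  unfolding has_derivative_at_alt
proof (intro conjI allI impI)
  show "bounded_linear ((*) lam)"
    by (rule bounded_linear_mult_right)
  fix e :: real
  assume "0 < e"
  then have "\<forall>\<^sub>F h in nhds 0. \<forall>\<epsilon>\<in>mc_idems.
      cmod (mc_comp (F (\<eta> + h) - F \<eta> - lam * h) \<epsilon>) \<le> e * cmod (mc_comp h \<epsilon>)"
    using assms unfolding has_mc_derivative_def by (intro eventually_ball_finite) auto
  then obtain d where d: "0 < d" "\<And>h \<epsilon>. norm h < d \<Longrightarrow> \<epsilon> \<in> mc_idems \<Longrightarrow>
      cmod (mc_comp (F (\<eta> + h) - F \<eta> - lam * h) \<epsilon>) \<le> e * cmod (mc_comp h \<epsilon>)"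
    unfolding eventually_nhds_metric by (auto simp: dist_norm)
  have "norm (F y - F \<eta> - lam * (y - \<eta>)) \<le> e * norm (y - \<eta>)" if "norm (y - \<eta>) < d" for y
    unfolding norm_mc_le_iff
  proof
    fix \<epsilon> :: "'a multicomplex"
    assume \<epsilon>: "\<epsilon> \<in> mc_idems"
    have "cmod (mc_comp (F y - F \<eta> - lam * (y - \<eta>)) \<epsilon>) \<le> e * cmod (mc_comp (y - \<eta>) \<epsilon>)"
      using d(2)[OF that \<epsilon>] by simp
    also have "\<dots> \<le> e * norm (y - \<eta>)"
      using \<open>0 < e\<close> \<epsilon> by (simp add: cmod_mc_comp_le)
    finally show "cmod (mc_comp (F y - F \<eta> - lam * (y - \<eta>)) \<epsilon>) \<le> e * norm (y - \<eta>)" .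
  qed
  then show "\<exists>d>0. \<forall>y. norm (y - \<eta>) < d \<longrightarrow> norm (F y - F \<eta> - lam * (y - \<eta>)) \<le> e * norm (y - \<eta>)"
    using d(1) by blast
qed

lemma mc_comp_quotient_error:
  assumes "h dvd 1" "\<epsilon> \<in> mc_idems"
  shows "cmod (mc_comp (mc_quotient F \<eta> h) \<epsilon> - mc_comp lam \<epsilon>) =
    cmod (mc_comp (F (\<eta> + h) - F \<eta> - lam * h) \<epsilon>) / cmod (mc_comp h \<epsilon>)"
  using assms unfolding mc_quotient_def
  by (simp add: mc_comp_divide mc_comp_simps mc_dvd_1_iff field_simps flip: norm_divide)

lemma has_mc_derivative_imp_tendsto_quotient:
  assumes "has_mc_derivative F lam \<eta>"
  shows "(mc_quotient F \<eta> \<longlongrightarrow> lam) (mc_incr U \<eta>)"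
  unfolding tendsto_mc_iff tendsto_iff
proof (intro ballI allI impI)
  fix \<epsilon> :: "'a multicomplex" and e :: real
  assume \<epsilon>: "\<epsilon> \<in> mc_idems" and e: "0 < e"
  have "\<forall>\<^sub>F h in nhds 0. cmod (mc_comp (F (\<eta> + h) - F \<eta> - lam * h) \<epsilon>) \<le> e / 2 * cmod (mc_comp h \<epsilon>)"
    using assms \<epsilon> e half_gt_zero unfolding has_mc_derivative_def by blast
  then show "\<forall>\<^sub>F h in mc_incr U \<eta>. dist (mc_comp (mc_quotient F \<eta> h) \<epsilon>) (mc_comp lam \<epsilon>) < e"
    unfolding mc_incr_def eventually_at_filter
  proof (rule eventually_mono, intro impI)
    fix h
    assume le: "cmod (mc_comp (F (\<eta> + h) - F \<eta> - lam * h) \<epsilon>) \<le> e / 2 * cmod (mc_comp h \<epsilon>)"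
      and h: "h \<in> {h. h dvd 1 \<and> \<eta> + h \<in> U}"
    then have "0 < cmod (mc_comp h \<epsilon>)"
      using \<epsilon> by (simp add: mc_dvd_1_iff)
    then have "cmod (mc_comp (F (\<eta> + h) - F \<eta> - lam * h) \<epsilon>) / cmod (mc_comp h \<epsilon>) \<le> e / 2"
      using le pos_divide_le_eq by blast
    also have "\<dots> < e"
      using e by simp
    finally show "dist (mc_comp (mc_quotient F \<eta> h) \<epsilon>) (mc_comp lam \<epsilon>) < e"
      using h \<epsilon> by (simp add: dist_norm mc_comp_quotient_error)
  qed
qed

text \<open>
  Small positive reals are admissible increments. They approach \<open>0\<close> through invertible elements and show
  that the limit defining \<open>mc_deriv\<close> is taken along a proper filter.
\<close>

lemma filterlim_of_real_mc_incr:
  assumes "open U" "\<eta> \<in> U"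
  shows "filterlim of_real (mc_incr U \<eta>) (at_right 0)"
proof -
  have lim: "((\<lambda>t. \<eta> + of_real t) \<longlongrightarrow> \<eta> + of_real 0) (at_right (0::real))"
    by (intro tendsto_intros)
  then have "\<forall>\<^sub>F t in at_right (0::real). \<eta> + of_real t \<in> U"
    using assms by (intro topological_tendstoD[OF lim]) auto
  moreover have "\<forall>\<^sub>F t in at_right (0::real). (of_real t :: 'a multicomplex) dvd 1 \<and> (of_real t :: 'a multicomplex) \<noteq> 0"
    by (auto simp: eventually_at_filter mc_dvd_1_iff mc_comp_of_real)
  moreover have "((of_real :: real \<Rightarrow> 'a multicomplex) \<longlongrightarrow> of_real 0) (at_right 0)"
    by (intro tendsto_intros)
  ultimately show ?thesis
    unfolding mc_incr_def filterlim_at by (auto elim: eventually_elim2)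
qed

lemma mc_incr_neq_bot: "open U \<Longrightarrow> \<eta> \<in> U \<Longrightarrow> mc_incr U \<eta> \<noteq> bot"
  using filterlim_of_real_mc_incr[of U \<eta>] filterlim_mono[of _ "mc_incr U \<eta>"]
  by (metis filterlim_def filtermap_bot_iff le_bot trivial_limit_at_right_real)

text \<open>
  The only form of continuity that a convergent quotient provides directly: along invertible
  increments.
\<close>

lemma tendsto_quotient_imp_tendsto_shift:
  fixes F :: "'n::finite multicomplex \<Rightarrow> 'n multicomplex"
  assumes "open U" "\<eta> \<in> U" "(mc_quotient F \<eta> \<longlongrightarrow> L) (mc_incr U \<eta>)"
  shows "((\<lambda>t. F (\<eta> + of_real t)) \<longlongrightarrow> F \<eta>) (at_right 0)"
proof -
  have "((\<lambda>t. mc_quotient F \<eta> (of_real t)) \<longlongrightarrow> L) (at_right 0)"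
    using filterlim_compose[OF assms(3) filterlim_of_real_mc_incr[OF assms(1,2)]] .
  then have "((\<lambda>t. F \<eta> + mc_quotient F \<eta> (of_real t) * of_real t) \<longlongrightarrow> F \<eta> + L * of_real 0) (at_right 0)"
    by (intro tendsto_intros)
  moreover have "\<forall>\<^sub>F t in at_right (0::real). F \<eta> + mc_quotient F \<eta> (of_real t) * of_real t = F (\<eta> + of_real t)"
    unfolding eventually_at_filter
  proof (intro always_eventually allI impI)
    fix t :: real
    assume "t \<noteq> 0"
    then have "(of_real t :: 'n multicomplex) dvd 1"
      by (simp add: mc_dvd_1_iff mc_comp_of_real)
    then show "F \<eta> + mc_quotient F \<eta> (of_real t) * of_real t = F (\<eta> + of_real t)"
      using \<open>t \<noteq> 0\<close>
      by (intro mc_eqI_comp) (simp add: mc_quotient_def mc_comp_simps mc_comp_divide)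
  qed
  ultimately show ?thesis
    by (auto elim: Lim_transform_eventually)
qed

text \<open>
  At \<open>\<eta>\<close> the quotients bound the error for invertible increments. A non-invertible \<open>h\<close> is
  approximated by the invertible \<open>h + t\<close> with real \<open>t > 0\<close>; the bound survives the limit \<open>t \<rightarrow> 0\<close>
  because convergence of the quotients at the neighbouring point \<open>\<eta> + h\<close> makes \<open>F\<close> continuous there
  in the direction of \<open>t\<close>. This is why convergence is required at all points of \<open>U\<close>.
\<close>

lemma tendsto_quotients_imp_has_mc_derivative:
  fixes F :: "'n::finite multicomplex \<Rightarrow> 'n multicomplex"
  assumes U: "open U" and \<eta>: "\<eta> \<in> U"
    and ex: "\<And>x. x \<in> U \<Longrightarrow> \<exists>L. (mc_quotient F x \<longlongrightarrow> L) (mc_incr U x)"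
    and lim: "(mc_quotient F \<eta> \<longlongrightarrow> L) (mc_incr U \<eta>)"
  shows "has_mc_derivative F L \<eta>"
  unfolding has_mc_derivative_def
proof (intro ballI allI impI)
  fix \<epsilon> :: "'n multicomplex" and e :: real
  assume \<epsilon>: "\<epsilon> \<in> mc_idems" and e: "0 < e"
  let ?E = "\<lambda>h. cmod (mc_comp (F (\<eta> + h) - F \<eta> - L * h) \<epsilon>)"
  have "\<forall>\<^sub>F h in mc_incr U \<eta>. cmod (mc_comp (mc_quotient F \<eta> h) \<epsilon> - mc_comp L \<epsilon>) < e"
    using lim \<epsilon> e unfolding tendsto_mc_iff tendsto_iff dist_norm by blast
  then obtain d where d: "0 < d" "\<And>h. norm h < d \<Longrightarrow> h \<noteq> 0 \<Longrightarrow> h dvd 1 \<Longrightarrow> \<eta> + h \<in> U \<Longrightarrow>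
      cmod (mc_comp (mc_quotient F \<eta> h) \<epsilon> - mc_comp L \<epsilon>) < e"
    unfolding mc_incr_def eventually_at by (auto simp: dist_norm)
  have inv: "?E h \<le> e * cmod (mc_comp h \<epsilon>)" if "norm h < d" "h dvd 1" "\<eta> + h \<in> U" for h
  proof -
    have pos: "0 < cmod (mc_comp h \<epsilon>)"
      using that \<epsilon> by (simp add: mc_dvd_1_iff)
    then have "h \<noteq> 0"
      using \<epsilon> by (auto simp: mc_comp_0)
    then have "?E h / cmod (mc_comp h \<epsilon>) < e"
      using d(2)[of h] that \<epsilon> by (simp add: mc_comp_quotient_error)
    then show ?thesis
      using pos by (simp add: divide_less_eq)
  qed
  have nbhd: "\<forall>\<^sub>F k in nhds x. norm k < d \<and> \<eta> + k \<in> U" if x: "norm x < d" "\<eta> + x \<in> U" for x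
  proof (rule eventually_conj)
    have "(norm \<longlongrightarrow> norm x) (nhds x)"
      by (intro tendsto_norm filterlim_ident)
    then show "\<forall>\<^sub>F k in nhds x. norm k < d"
      using x(1) by (rule order_tendstoD)
    have "((\<lambda>k. \<eta> + k) \<longlongrightarrow> \<eta> + x) (nhds x)"
      by (intro tendsto_intros filterlim_ident)
    then show "\<forall>\<^sub>F k in nhds x. \<eta> + k \<in> U"
      using U x(2) by (rule topological_tendstoD)
  qed
  have all: "?E h \<le> e * cmod (mc_comp h \<epsilon>)" if h: "norm h < d" "\<eta> + h \<in> U" for h
  proof (rule tendsto_le)
    have "((\<lambda>t. F (\<eta> + h + of_real t)) \<longlongrightarrow> F (\<eta> + h)) (at_right 0)"
      using ex[OF h(2)] tendsto_quotient_imp_tendsto_shift[OF U h(2)] by blast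
    then have "((\<lambda>t. F (\<eta> + (h + of_real t)) - F \<eta> - L * (h + of_real t)) \<longlongrightarrow>
        F (\<eta> + h) - F \<eta> - L * (h + of_real 0)) (at_right 0)"
      unfolding add.assoc[of \<eta> h] by (intro tendsto_intros)
    then show "((\<lambda>t. ?E (h + of_real t)) \<longlongrightarrow> ?E h) (at_right 0)"
      using \<epsilon> by (intro tendsto_norm bounded_linear.tendsto[OF bounded_linear_mc_comp]) auto
    have shift: "((\<lambda>t. h + of_real t) \<longlongrightarrow> h + of_real 0) (at_right (0::real))"
      by (intro tendsto_intros)
    then show "((\<lambda>t. e * cmod (mc_comp (h + of_real t) \<epsilon>)) \<longlongrightarrow> e * cmod (mc_comp h \<epsilon>)) (at_right 0)"
      using \<epsilon> by (intro tendsto_mult_left tendsto_norm bounded_linear.tendsto[OF bounded_linear_mc_comp]) auto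
    from shift have "filterlim (\<lambda>t. h + of_real t) (nhds h) (at_right (0::real))"
      by simp
    then have near: "\<forall>\<^sub>F t in at_right (0::real). norm (h + of_real t) < d \<and> \<eta> + (h + of_real t) \<in> U"
      using nbhd[OF h] by (rule eventually_compose_filterlim[rotated])
    (* A component of h + t can vanish for one value of t only. *)
    have "\<forall>\<^sub>F t in at_right (0::real). \<forall>\<delta>\<in>(mc_idems :: 'n multicomplex set). t \<noteq> - Re (mc_comp h \<delta>)"
      by (intro eventually_ball_finite ballI eventually_neq_at_within) simp
    then have "\<forall>\<^sub>F t in at_right (0::real). h + of_real t dvd 1"
      by (rule eventually_mono) (auto simp: mc_dvd_1_iff mc_comp_simps complex_eq_iff)
    with near show "\<forall>\<^sub>F t in at_right 0. ?E (h + of_real t) \<le> e * cmod (mc_comp (h + of_real t) \<epsilon>)"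
      by eventually_elim (use inv in blast)
  qed simp
  have "\<forall>\<^sub>F h in nhds 0. norm h < d \<and> \<eta> + h \<in> U"
    using nbhd[of 0] \<eta> d(1) by simp
  then show "\<forall>\<^sub>F h in nhds 0. ?E h \<le> e * cmod (mc_comp h \<epsilon>)"
    by (rule eventually_mono) (use all in blast)
qed

section \<open>Splitting into holomorphic functions of one variable\<close>

text \<open>
  Along the segment from \<open>x\<close> to \<open>y\<close> the component \<open>\<epsilon>\<close> of \<open>F\<close> has the derivative
  \<open>\<lambda>\<^sub>\<epsilon> (y - x)\<^sub>\<epsilon> = 0\<close>, so it is constant.
\<close>

lemma mc_linear_derivative_imp_comp_depends_on_comp:
  fixes F :: "'n::finite multicomplex \<Rightarrow> 'n multicomplex"
  assumes "convex S" "x \<in> S" "y \<in> S"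
    and \<epsilon>: "\<epsilon> \<in> mc_idems" and eq: "mc_comp x \<epsilon> = mc_comp y \<epsilon>"
    and der: "\<And>\<eta>. \<eta> \<in> S \<Longrightarrow> \<exists>lam. (F has_derivative (\<lambda>h. lam * h)) (at \<eta>)"
  shows "mc_comp (F x) \<epsilon> = mc_comp (F y) \<epsilon>"
proof -
  let ?p = "\<lambda>t. x + t *\<^sub>R (y - x)"
  have "((\<lambda>t. mc_comp (F (?p t)) \<epsilon>) has_derivative (\<lambda>h. 0)) (at t within {0..1})"
    if t: "t \<in> {0..1}" for t :: real
  proof -
    have "?p t = (1 - t) *\<^sub>R x + t *\<^sub>R y"
      by (simp add: algebra_simps)
    then have "?p t \<in> S"
      using assms(1-3) t by (simp add: convexD_alt)
    then obtain l where l: "(F has_derivative (\<lambda>h. l * h)) (at (?p t))"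
      using der by blast
    have p: "(?p has_derivative (\<lambda>h. h *\<^sub>R (y - x))) (at t within {0..1})"
      by (auto intro!: derivative_eq_intros)
    have "((\<lambda>t. mc_comp (F (?p t)) \<epsilon>) has_derivative (\<lambda>h. mc_comp (l * (h *\<^sub>R (y - x))) \<epsilon>)) (at t within {0..1})"
      by (rule bounded_linear.has_derivative[OF bounded_linear_mc_comp[OF \<epsilon>]])
        (use has_derivative_compose[OF p l] in simp)
    then show ?thesis
      using \<epsilon> eq by (simp add: mc_comp_simps)
  qed
  then obtain c where "\<And>t. t \<in> {0..1::real} \<Longrightarrow> mc_comp (F (?p t)) \<epsilon> = c"
    using has_derivative_zero_constant[of "{0..1::real}" "\<lambda>t. mc_comp (F (?p t)) \<epsilon>"] by auto
  from this[of 0] this[of 1] show ?thesis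
    by simp
qed

text \<open>
  The function \<open>\<phi>\<^sub>\<epsilon>\<close> is the component \<open>\<epsilon>\<close> of \<open>F\<close> restricted to the complex line through the
  centre in the direction \<open>\<epsilon>\<close>. Its derivative exists by the chain rule and is multiplication by
  \<open>\<lambda>\<^sub>\<epsilon>\<close>, hence complex linear.
\<close>

lemma mc_linear_derivative_imp_split:
  fixes F :: "'n::finite multicomplex \<Rightarrow> 'n multicomplex"
  assumes der: "\<And>\<eta>. \<eta> \<in> polydisc a r \<Longrightarrow> \<exists>lam. (F has_derivative (\<lambda>h. lam * h)) (at \<eta>)"
  shows "\<exists>\<phi>. mc_split_on F a r \<phi>"
proof
  (* p eps z has component z at eps and the components of the centre elsewhere. *)
  define p where "p \<epsilon> z = a + mc_embed (z - mc_comp a \<epsilon>) * \<epsilon>" for \<epsilon> :: "'n multicomplex" and z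
  define \<phi> where "\<phi> \<epsilon> z = mc_comp (F (p \<epsilon> z)) \<epsilon>" for \<epsilon> z
  have p_in: "p \<epsilon> z \<in> polydisc a r" if "\<epsilon> \<in> mc_idems" "cmod (z - mc_comp a \<epsilon>) < r" for \<epsilon> z
    unfolding polydisc_def mem_Collect_eq norm_mc_less_iff
    using that le_less_trans[OF norm_ge_zero that(2)]
    by (auto simp: p_def mc_comp_simps)
  show "mc_split_on F a r \<phi>"
    unfolding mc_split_on_def
  proof (intro conjI ballI)
    fix \<epsilon> :: "'n multicomplex"
    assume \<epsilon>: "\<epsilon> \<in> mc_idems"
    show "\<phi> \<epsilon> holomorphic_on {z. cmod (z - mc_comp a \<epsilon>) < r}"
      unfolding holomorphic_on_def
    proof
      fix z assume "z \<in> {z. cmod (z - mc_comp a \<epsilon>) < r}"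
      then obtain l where l: "(F has_derivative (\<lambda>h. l * h)) (at (p \<epsilon> z))"
        using p_in[OF \<epsilon>] der by blast
      have "((\<lambda>z. z - mc_comp a \<epsilon>) has_derivative (\<lambda>w. w)) (at z)"
        by (auto intro!: derivative_eq_intros)
      then have "((\<lambda>z. mc_embed (z - mc_comp a \<epsilon>) * \<epsilon>) has_derivative (\<lambda>w. mc_embed w * \<epsilon>)) (at z)"
        by (rule bounded_linear.has_derivative[OF bounded_linear_mc_embed_mult[OF \<epsilon>]])
      from has_derivative_add[OF has_derivative_const[of a] this]
      have p: "(p \<epsilon> has_derivative (\<lambda>w. mc_embed w * \<epsilon>)) (at z)"
        by (simp add: p_def[abs_def])
      have "(\<phi> \<epsilon> has_derivative (\<lambda>w. mc_comp (l * (mc_embed w * \<epsilon>)) \<epsilon>)) (at z)"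
        unfolding \<phi>_def
        by (rule bounded_linear.has_derivative[OF bounded_linear_mc_comp[OF \<epsilon>]])
          (use has_derivative_compose[OF p l] in simp)
      then have "(\<phi> \<epsilon> has_derivative (\<lambda>w. mc_comp l \<epsilon> * w)) (at z)"
        using \<epsilon> by (simp add: mc_comp_simps)
      then have "(\<phi> \<epsilon> has_field_derivative mc_comp l \<epsilon>) (at z)"
        by (simp add: has_field_derivative_def)
      then show "\<phi> \<epsilon> field_differentiable at z within {z. cmod (z - mc_comp a \<epsilon>) < r}"
        using field_differentiable_def field_differentiable_at_within by blast
    qed
  next
    fix \<eta> assume \<eta>: "\<eta> \<in> polydisc a r"
    show "F \<eta> = (\<Sum>\<epsilon>\<in>mc_idems. mc_embed (\<phi> \<epsilon> (mc_comp \<eta> \<epsilon>)) * \<epsilon>)"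
    proof (rule mc_eqI_comp)
      fix \<epsilon> :: "'n multicomplex"
      assume \<epsilon>: "\<epsilon> \<in> mc_idems"
      have "cmod (mc_comp \<eta> \<epsilon> - mc_comp a \<epsilon>) < r"
        using \<eta> \<epsilon> by (auto simp: polydisc_def norm_mc_less_iff mc_comp_diff)
      then have p: "p \<epsilon> (mc_comp \<eta> \<epsilon>) \<in> polydisc a r"
        by (rule p_in[OF \<epsilon>])
      have "mc_comp \<eta> \<epsilon> = mc_comp (p \<epsilon> (mc_comp \<eta> \<epsilon>)) \<epsilon>"
        using \<epsilon> by (simp add: p_def mc_comp_simps)
      moreover have "convex (polydisc a r)"
        by (simp add: polydisc_eq_ball)
      ultimately have "mc_comp (F \<eta>) \<epsilon> = mc_comp (F (p \<epsilon> (mc_comp \<eta> \<epsilon>))) \<epsilon>"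
        using mc_linear_derivative_imp_comp_depends_on_comp[OF _ \<eta> p \<epsilon> _ der] by blast
      then show "mc_comp (F \<eta>) \<epsilon> = mc_comp (\<Sum>\<epsilon>\<in>mc_idems. mc_embed (\<phi> \<epsilon> (mc_comp \<eta> \<epsilon>)) * \<epsilon>) \<epsilon>"
        using \<epsilon> by (simp add: mc_comp_sum_idems \<phi>_def)
    qed
  qed
qed

text \<open>
  The component \<open>\<epsilon>\<close> of the error is the error of the first-order expansion of \<open>\<phi>\<^sub>\<epsilon>\<close>, which
  involves \<open>h\<^sub>\<epsilon>\<close> only.
\<close>

lemma mc_split_imp_has_mc_derivative:
  fixes F :: "'n::finite multicomplex \<Rightarrow> 'n multicomplex"
  assumes split: "mc_split_on F a r \<phi>" and \<eta>: "\<eta> \<in> polydisc a r"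
  shows "has_mc_derivative F (\<Sum>\<epsilon>\<in>mc_idems. mc_embed (deriv (\<phi> \<epsilon>) (mc_comp \<eta> \<epsilon>)) * \<epsilon>) \<eta>"
    (is "has_mc_derivative F ?lam \<eta>")
  unfolding has_mc_derivative_def
proof (intro ballI allI impI)
  fix \<epsilon> :: "'n multicomplex" and e :: real
  assume \<epsilon>: "\<epsilon> \<in> mc_idems" and e: "0 < e"
  let ?z = "mc_comp \<eta> \<epsilon>"
  have "?z \<in> ball (mc_comp a \<epsilon>) r"
    using \<eta> \<epsilon> by (auto simp: polydisc_def norm_mc_less_iff mc_comp_diff dist_norm norm_minus_commute)
  moreover have "\<phi> \<epsilon> holomorphic_on ball (mc_comp a \<epsilon>) r"
    using split \<epsilon> unfolding mc_split_on_def ball_def by (simp add: dist_norm norm_minus_commute)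
  ultimately have "(\<phi> \<epsilon> has_derivative (\<lambda>w. deriv (\<phi> \<epsilon>) ?z * w)) (at ?z)"
    using holomorphic_derivI[OF _ open_ball] has_field_derivative_def by blast
  then obtain d where d: "0 < d" "\<And>z. cmod (z - ?z) < d \<Longrightarrow>
      cmod (\<phi> \<epsilon> z - \<phi> \<epsilon> ?z - deriv (\<phi> \<epsilon>) ?z * (z - ?z)) \<le> e * cmod (z - ?z)"
    using e unfolding has_derivative_at_alt by blast
  have "\<forall>\<^sub>F h in nhds 0. norm h < d"
    using d(1) unfolding eventually_nhds_metric by (auto simp: dist_norm)
  moreover have "\<forall>\<^sub>F h in nhds 0. \<eta> + h \<in> polydisc a r"
  proof -
    have "((\<lambda>h. \<eta> + h) \<longlongrightarrow> \<eta> + 0) (nhds 0)"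
      by (intro tendsto_intros filterlim_ident)
    then show ?thesis
      using \<eta> by (rule_tac topological_tendstoD) (auto simp: polydisc_eq_ball)
  qed
  ultimately show "\<forall>\<^sub>F h in nhds 0. cmod (mc_comp (F (\<eta> + h) - F \<eta> - ?lam * h) \<epsilon>) \<le> e * cmod (mc_comp h \<epsilon>)"
  proof eventually_elim
    case (elim h)
    have F: "mc_comp (F x) \<epsilon> = \<phi> \<epsilon> (mc_comp x \<epsilon>)" if "x \<in> polydisc a r" for x
      using split that \<epsilon> unfolding mc_split_on_def by (simp add: mc_comp_sum_idems)
    have "cmod (mc_comp h \<epsilon>) < d"
      using elim(1) cmod_mc_comp_le[OF \<epsilon>, of h] by simp
    then show ?case
      using d(2)[of "mc_comp (\<eta> + h) \<epsilon>"] F[OF elim(2)] F[OF \<eta>] \<epsilon>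
      by (simp add: mc_comp_simps mc_comp_sum_idems)
  qed
qed

section \<open>Smoothness\<close>

definition mc_locally_split_on ::
  "('n::finite multicomplex \<Rightarrow> 'n multicomplex) \<Rightarrow> 'n multicomplex set \<Rightarrow> bool" where
  "mc_locally_split_on F U \<longleftrightarrow>
     (\<forall>p\<in>U. \<exists>a r \<phi>. 0 < r \<and> p \<in> polydisc a r \<and> polydisc a r \<subseteq> U \<and> mc_split_on F a r \<phi>)"

lemma mc_locally_split_imp_has_mc_derivative:
  assumes "mc_locally_split_on F U" "\<eta> \<in> U"
  shows "\<exists>lam. has_mc_derivative F lam \<eta>"
  using assms mc_split_imp_has_mc_derivative unfolding mc_locally_split_on_def by blast

lemma frechet_derivative_mc_split:
  assumes "mc_split_on F a r \<phi>" "\<eta> \<in> polydisc a r"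
  shows "frechet_derivative F (at \<eta>) h =
    (\<Sum>\<epsilon>\<in>mc_idems. mc_embed (deriv (\<phi> \<epsilon>) (mc_comp \<eta> \<epsilon>)) * \<epsilon>) * h"
  using frechet_derivative_at[OF has_mc_derivative_imp_has_derivative[OF mc_split_imp_has_mc_derivative[OF assms]]]
  by metis

text \<open>
  The new functions of one variable are \<open>z \<mapsto> \<phi>\<^sub>\<epsilon>' z \<cdot> h\<^sub>\<epsilon>\<close>. This closure property drives the
  induction on the order of differentiability.
\<close>

lemma mc_locally_split_frechet_derivative:
  assumes "mc_locally_split_on F U"
  shows "mc_locally_split_on (\<lambda>\<eta>. frechet_derivative F (at \<eta>) h) U"
  unfolding mc_locally_split_on_def
proof
  fix p assume "p \<in> U"
  then obtain a r \<phi> where ar: "0 < r" "p \<in> polydisc a r" "polydisc a r \<subseteq> U" and \<phi>: "mc_split_on F a r \<phi>"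
    using assms unfolding mc_locally_split_on_def by metis
  have "mc_split_on (\<lambda>\<eta>. frechet_derivative F (at \<eta>) h) a r (\<lambda>\<epsilon> z. deriv (\<phi> \<epsilon>) z * mc_comp h \<epsilon>)"
    unfolding mc_split_on_def
  proof (intro conjI ballI)
    fix \<epsilon> :: "'a multicomplex" assume "\<epsilon> \<in> mc_idems"
    then have hol: "\<phi> \<epsilon> holomorphic_on {z. cmod (z - mc_comp a \<epsilon>) < r}"
      using \<phi> by (simp add: mc_split_on_def)
    have "{z. cmod (z - mc_comp a \<epsilon>) < r} = ball (mc_comp a \<epsilon>) r"
      by (auto simp: dist_norm norm_minus_commute)
    with hol show "(\<lambda>z. deriv (\<phi> \<epsilon>) z * mc_comp h \<epsilon>) holomorphic_on {z. cmod (z - mc_comp a \<epsilon>) < r}"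
      by (auto intro!: holomorphic_intros)
  next
    fix \<eta> assume "\<eta> \<in> polydisc a r"
    then show "frechet_derivative F (at \<eta>) h =
        (\<Sum>\<epsilon>\<in>mc_idems. mc_embed (deriv (\<phi> \<epsilon>) (mc_comp \<eta> \<epsilon>) * mc_comp h \<epsilon>) * \<epsilon>)"
      by (intro mc_eqI_comp) (simp add: frechet_derivative_mc_split[OF \<phi>] mc_comp_mult mc_comp_sum_idems)
  qed
  then show "\<exists>a r \<phi>. 0 < r \<and> p \<in> polydisc a r \<and> polydisc a r \<subseteq> U \<and>
      mc_split_on (\<lambda>\<eta>. frechet_derivative F (at \<eta>) h) a r \<phi>"
    using ar by blast
qed

lemma mc_locally_split_imp_Ck_on: "mc_locally_split_on F U \<Longrightarrow> Ck_on k U F"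
proof (induction k arbitrary: F)
  case 0
  have "isCont F \<eta>" if "\<eta> \<in> U" for \<eta>
    using mc_locally_split_imp_has_mc_derivative[OF 0 that] has_mc_derivative_imp_has_derivative
      has_derivative_continuous by blast
  then show ?case
    by (simp add: continuous_at_imp_continuous_on)
next
  case (Suc k)
  have "F differentiable (at \<eta>)" if "\<eta> \<in> U" for \<eta>
    using mc_locally_split_imp_has_mc_derivative[OF Suc.prems that] has_mc_derivative_imp_has_derivative
    unfolding differentiable_def by blast
  moreover have "Ck_on k U (\<lambda>\<eta>. frechet_derivative F (at \<eta>) h)" for h
    using Suc.IH[OF mc_locally_split_frechet_derivative[OF Suc.prems]] .
  ultimately show ?case
    by simp
qed

section \<open>The equivalence\<close>

lemma mc_linear_derivative_imp_locally_split:
  assumes "open U" and der: "\<And>\<eta>. \<eta> \<in> U \<Longrightarrow> \<exists>lam. (F has_derivative (\<lambda>h. lam * h)) (at \<eta>)"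
  shows "mc_locally_split_on F U"
  unfolding mc_locally_split_on_def
proof
  fix p assume "p \<in> U"
  then obtain r where r: "0 < r" "polydisc p r \<subseteq> U"
    using \<open>open U\<close> unfolding polydisc_eq_ball by (meson openE)
  then obtain \<phi> where "mc_split_on F p r \<phi>"
    using mc_linear_derivative_imp_split[of p r F] der by blast
  then show "\<exists>a r \<phi>. 0 < r \<and> p \<in> polydisc a r \<and> polydisc a r \<subseteq> U \<and> mc_split_on F a r \<phi>"
    using r by (intro exI[of _ p] exI[of _ r] exI[of _ \<phi>]) (simp add: polydisc_def)
qed

lemma mc_holomorphic_on_iff_locally_split:
  assumes "open U"
  shows "mc_holomorphic_on F U \<longleftrightarrow> mc_locally_split_on F U"
proof
  assume hol: "mc_holomorphic_on F U"
  show "mc_locally_split_on F U"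
  proof (rule mc_linear_derivative_imp_locally_split[OF assms])
    fix \<eta> assume "\<eta> \<in> U"
    then have "F differentiable (at \<eta>)" "\<exists>lam. frechet_derivative F (at \<eta>) = (\<lambda>h. lam * h)"
      using hol by (auto simp: mc_holomorphic_on_def fun_eq_iff)
    then show "\<exists>lam. (F has_derivative (\<lambda>h. lam * h)) (at \<eta>)"
      by (metis frechet_derivative_works)
  qed
next
  assume split: "mc_locally_split_on F U"
  have "\<exists>lam. \<forall>h. frechet_derivative F (at \<eta>) h = lam * h" if "\<eta> \<in> U" for \<eta>
    using mc_locally_split_imp_has_mc_derivative[OF split that]
    by (metis frechet_derivative_at has_mc_derivative_imp_has_derivative)
  then show "mc_holomorphic_on F U"
    using mc_locally_split_imp_Ck_on[OF split] by (simp add: mc_holomorphic_on_def del: Ck_on.simps)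
qed

lemma tendsto_quotients_iff_locally_split:
  assumes "open U"
  shows "(\<forall>\<eta>\<in>U. \<exists>L. (mc_quotient F \<eta> \<longlongrightarrow> L) (mc_incr U \<eta>)) \<longleftrightarrow> mc_locally_split_on F U"
proof
  assume lim: "\<forall>\<eta>\<in>U. \<exists>L. (mc_quotient F \<eta> \<longlongrightarrow> L) (mc_incr U \<eta>)"
  show "mc_locally_split_on F U"
  proof (rule mc_linear_derivative_imp_locally_split[OF assms])
    fix \<eta> assume "\<eta> \<in> U"
    then show "\<exists>lam. (F has_derivative (\<lambda>h. lam * h)) (at \<eta>)"
      using tendsto_quotients_imp_has_mc_derivative[OF assms] lim has_mc_derivative_imp_has_derivative
      by metis
  qed
next
  assume "mc_locally_split_on F U"
  then show "\<forall>\<eta>\<in>U. \<exists>L. (mc_quotient F \<eta> \<longlongrightarrow> L) (mc_incr U \<eta>)"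
    using mc_locally_split_imp_has_mc_derivative has_mc_derivative_imp_tendsto_quotient by metis
qed

lemma mc_deriv_eqI:
  assumes "open U" "\<eta> \<in> U" "has_mc_derivative F lam \<eta>"
  shows "mc_deriv F U \<eta> = lam"
  unfolding mc_deriv_def
  using assms by (intro tendsto_Lim mc_incr_neq_bot has_mc_derivative_imp_tendsto_quotient)

theorem proposition2p3:
  fixes U :: "'n::finite multicomplex set"
    and F :: "'n multicomplex \<Rightarrow> 'n multicomplex"
  assumes "open U"
  shows "(mc_holomorphic_on F U \<longleftrightarrow> (\<forall>\<eta>\<^sub>0\<in>U. \<exists>L. (mc_quotient F \<eta>\<^sub>0 \<longlongrightarrow> L) (mc_incr U \<eta>\<^sub>0)))
    \<and> (mc_holomorphic_on F U \<longleftrightarrow>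
        (\<forall>p\<in>U. \<exists>a r \<phi>. 0 < r \<and> p \<in> polydisc a r \<and> polydisc a r \<subseteq> U \<and> mc_split_on F a r \<phi>))
    \<and> (mc_holomorphic_on F U \<longrightarrow>
        (\<forall>k. Ck_on k U F)
        \<and> (\<forall>\<eta>\<in>U. \<forall>lam. (\<forall>h. frechet_derivative F (at \<eta>) h = lam * h) \<longrightarrow>
              mc_deriv F U \<eta> = lam \<and> lam = frechet_derivative F (at \<eta>) 1)
        \<and> (\<forall>a r \<phi>. 0 < r \<and> polydisc a r \<subseteq> U \<and> mc_split_on F a r \<phi> \<longrightarrow>
              (\<forall>\<eta>\<in>polydisc a r. mc_deriv F U \<eta> =
                 (\<Sum>\<epsilon>\<in>mc_idems. mc_embed (deriv (\<phi> \<epsilon>) (mc_comp \<eta> \<epsilon>)) * \<epsilon>))))"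
proof (intro conjI impI allI ballI)
  show "mc_holomorphic_on F U \<longleftrightarrow> (\<forall>\<eta>\<^sub>0\<in>U. \<exists>L. (mc_quotient F \<eta>\<^sub>0 \<longlongrightarrow> L) (mc_incr U \<eta>\<^sub>0))"
    using mc_holomorphic_on_iff_locally_split tendsto_quotients_iff_locally_split assms by blast
  show iii: "mc_holomorphic_on F U \<longleftrightarrow>
      (\<forall>p\<in>U. \<exists>a r \<phi>. 0 < r \<and> p \<in> polydisc a r \<and> polydisc a r \<subseteq> U \<and> mc_split_on F a r \<phi>)"
    using mc_holomorphic_on_iff_locally_split[OF assms] unfolding mc_locally_split_on_def .
next
  assume "mc_holomorphic_on F U"
  then have split: "mc_locally_split_on F U"
    using mc_holomorphic_on_iff_locally_split[OF assms] by blast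
  show "Ck_on k U F" for k
    using split by (rule mc_locally_split_imp_Ck_on)
  fix \<eta> lam
  assume \<eta>: "\<eta> \<in> U" and lam: "\<forall>h. frechet_derivative F (at \<eta>) h = lam * h"
  then show "lam = frechet_derivative F (at \<eta>) 1"
    by simp
  obtain l where l: "has_mc_derivative F l \<eta>"
    using mc_locally_split_imp_has_mc_derivative[OF split \<eta>] by blast
  then have "lam * 1 = l * 1"
    using lam frechet_derivative_at[OF has_mc_derivative_imp_has_derivative] by metis
  then show "mc_deriv F U \<eta> = lam"
    using mc_deriv_eqI[OF assms \<eta> l] by simp
next
  fix a r \<phi> \<eta>
  assume "0 < r \<and> polydisc a r \<subseteq> U \<and> mc_split_on F a r \<phi>" "\<eta> \<in> polydisc a r"
  then show "mc_deriv F U \<eta> = (\<Sum>\<epsilon>\<in>mc_idems. mc_embed (deriv (\<phi> \<epsilon>) (mc_comp \<eta> \<epsilon>)) * \<epsilon>)"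
    using assms by (intro mc_deriv_eqI mc_split_imp_has_mc_derivative) auto
qed

end
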